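(* For $k\ge 1$ let $\delta_k=(k-1,k-2,\ldots,2,1)$ be the staircase partition, let $\upsilon_k=\delta_{2k}/\delta_k$, let $n=|\upsilon_k|=k(3k-1)/2$, and let $f^{\upsilon_k}$ be the number of standard Young tableaux of skew shape $\upsilon_k$. Then, as $k\to\infty$, $$\frac16-\frac32\log 2+\frac12\log 3+o(1)\ \le\ \frac1n\left(\log f^{\upsilon_k}-\frac12\,n\log n\right)\ \le\ \frac16-\frac72\log 2+2\log 3+o(1).$$
   Context: $\log$ denotes the natural logarithm. $|\lambda/\mu|$ is the number of cells of the skew shape $\lambda/\mu$. A standard Young tableau of skew shape $\lambda/\mu$ with $n$ cells is a bijective filling of the cells with $1,\ldots,n$, increasing along rows (left to right) and down columns. *)

theory Defs
  imports Complex_Main "HOL-Library.FuncSet" "HOL-Library.Landau_Symbols"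
begin

text \<open>A partition is the weakly decreasing list of its positive parts. Cells are pairs
  (row, column), both counted from 0, with row 0 at the top (English convention).\<close>

definition is_partition :: "nat list \<Rightarrow> bool" where
  "is_partition lam \<longleftrightarrow> sorted_wrt (\<ge>) lam \<and> 0 \<notin> set lam"

definition young_diagram :: "nat list \<Rightarrow> (nat \<times> nat) set" where
  "young_diagram lam = {(i, j). i < length lam \<and> j < lam ! i}"

text \<open>Meaningful as a skew shape only if the diagram of \<open>mu\<close> is contained in that of \<open>lam\<close>.\<close>

definition skew_shape :: "nat list \<Rightarrow> nat list \<Rightarrow> (nat \<times> nat) set" where
  "skew_shape lam mu = young_diagram lam - young_diagram mu"

text \<open>Tableaux are extensional functions (\<open>undefined\<close> outside the shape), so that distinct
  elements of this set are distinct fillings of the cells.\<close>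

definition standard_young_tableaux :: "(nat \<times> nat) set \<Rightarrow> (nat \<times> nat \<Rightarrow> nat) set" where
  "standard_young_tableaux S =
     {T \<in> extensional S. bij_betw T S {1..card S} \<and>
        (\<forall>i j j'. (i, j) \<in> S \<longrightarrow> (i, j') \<in> S \<longrightarrow> j < j' \<longrightarrow> T (i, j) < T (i, j')) \<and>
        (\<forall>i i' j. (i, j) \<in> S \<longrightarrow> (i', j) \<in> S \<longrightarrow> i < i' \<longrightarrow> T (i, j) < T (i', j))}"

definition num_SYT :: "(nat \<times> nat) set \<Rightarrow> nat" where
  "num_SYT S = card (standard_young_tableaux S)"

definition staircase :: "nat \<Rightarrow> nat list" where
  "staircase k = rev [1..<k]"

definition upsilon :: "nat \<Rightarrow> (nat \<times> nat) set" where
  "upsilon k = skew_shape (staircase (2 * k)) (staircase k)"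

lemma is_partition_staircase: "is_partition (staircase k)"
  by (auto simp: is_partition_def staircase_def sorted_wrt_rev intro: sorted_wrt_mono_rel[OF _ sorted_wrt_upt])

lemma young_diagram_staircase: "young_diagram (staircase k) = {(i, j). i + j + 1 < k}"
  by (auto simp: young_diagram_def staircase_def rev_nth)

lemma young_diagram_staircase_subset:
  "young_diagram (staircase k) \<subseteq> young_diagram (staircase (2 * k))"
  by (auto simp: young_diagram_staircase)

lemma finite_young_diagram_staircase: "finite (young_diagram (staircase k))"
  by (rule finite_subset[of _ "{..<k} \<times> {..<k}"]) (auto simp: young_diagram_staircase)

lemma card_young_diagram_staircase: "2 * card (young_diagram (staircase k)) = k * (k - 1)"
proof (induction k)
  case 0
  then show ?case by (simp add: young_diagram_staircase)
next
  case (Suc k)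
  have eq: "young_diagram (staircase (Suc k)) =
      young_diagram (staircase k) \<union> (\<lambda>i. (i, k - 1 - i)) ` {..<k}"
    by (auto simp: young_diagram_staircase image_iff)
  have "card (young_diagram (staircase (Suc k))) = card (young_diagram (staircase k)) + k"
    unfolding eq
    using finite_young_diagram_staircase[of k]
    by (subst card_Un_disjoint) (auto simp: young_diagram_staircase card_image inj_on_def)
  with Suc show ?case by (cases k) (auto simp: algebra_simps)
qed

lemma card_upsilon: "card (upsilon k) = k * (3 * k - 1) div 2"
proof -
  have "card (upsilon k) =
      card (young_diagram (staircase (2 * k))) - card (young_diagram (staircase k))"
    unfolding upsilon_def skew_shape_def
    by (rule card_Diff_subset[OF finite_young_diagram_staircase young_diagram_staircase_subset])
  then have "2 * card (upsilon k) = 2 * k * (2 * k - 1) - k * (k - 1)"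
    using card_young_diagram_staircase[of k] card_young_diagram_staircase[of "2 * k"] by simp
  also have "\<dots> = k * (3 * k - 1)"
    by (cases k) (auto simp: algebra_simps)
  finally show ?thesis by simp
qed

end

theory Submission
  imports Defs "HOL-Real_Asymp.Real_Asymp"
begin

text \<open>
  Let \<open>M \<subseteq> D\<close> be Young diagrams, \<open>h\<^sub>D\<close> the hook lengths of \<open>D\<close>, and
  \<open>F(D, M) = \<bar>D - M\<bar>! / (\<Prod>u\<in>D - M. h\<^sub>D u)\<close>. The Greene--Nijenhuis--Wilf hook walk in \<open>D\<close>,
  started uniformly in \<open>D - M\<close>, never leaves \<open>D - M\<close>, and it ends at a corner \<open>c\<close> with probability
  at most \<open>F(D - c, M) / F(D, M)\<close>, with equality if \<open>M\<close> is empty. Summing over the corners,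
  \<open>F(D, M) \<le> (\<Sum>c. F(D - c, M))\<close>, with equality for empty \<open>M\<close>. The number of tableaux of shape
  \<open>D - M\<close> satisfies the corresponding recursion, so by induction it is at least \<open>F(D, M)\<close> and at most
  \<open>F(D, {}) / F(M, {})\<close>. For staircases the lower bound has exactly the claimed growth constant, and
  the constant of the upper bound, \<open>1/2 - ln 2 / 6 - ln 3 / 2\<close>, is smaller than the claimed one.
\<close>

section \<open>Removing the largest entry of a tableau\<close>

text \<open>Nothing may follow in the row or the column of the cell, adjacent or not. In this form
  the largest entry of a tableau on any finite set of cells sits in a corner.\<close>

definition corners :: "(nat \<times> nat) set \<Rightarrow> (nat \<times> nat) set" where
  "corners S = {(i, j) \<in> S. (\<forall>j'>j. (i, j') \<notin> S) \<and> (\<forall>i'>i. (i', j) \<notin> S)}"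

lemma cornersD:
  assumes "(i, j) \<in> corners S"
  shows "(i, j) \<in> S" "(i, j') \<in> S \<Longrightarrow> j' \<le> j" "(i', j) \<in> S \<Longrightarrow> i' \<le> i"
  using assms unfolding corners_def by (auto intro!: leI)

lemma corners_subset: "corners S \<subseteq> S"
  by (auto simp: corners_def)

lemma finite_standard_young_tableaux:
  assumes "finite S"
  shows "finite (standard_young_tableaux S)"
proof (rule finite_subset)
  show "standard_young_tableaux S \<subseteq> S \<rightarrow>\<^sub>E {1..card S}"
    by (auto simp: standard_young_tableaux_def PiE_def bij_betw_def)
  show "finite (S \<rightarrow>\<^sub>E {1..card S})"
    using assms by (intro finite_PiE) auto
qed

text \<open>Nothing follows a corner in its row or its column, so the new largest value
  \<open>card S\<close> only ever appears as the larger side of a comparison.\<close>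

lemma standard_young_tableaux_extend:
  assumes "finite S" and c: "c \<in> corners S" and T: "T \<in> standard_young_tableaux (S - {c})"
  shows "T(c := card S) \<in> standard_young_tableaux S"
proof -
  obtain a b where ab: "c = (a, b)" by force
  have cS: "c \<in> S" using c corners_subset by blast
  have pos: "card S > 0" using assms(1) cS card_gt_0_iff by blast
  have card': "card (S - {c}) = card S - 1" using cS by simp
  have bij: "bij_betw T (S - {c}) {1..card S - 1}" and ext: "T \<in> extensional (S - {c})"
    using T by (auto simp: standard_young_tableaux_def card')
  have lt: "T u < card S" if "u \<in> S" "u \<noteq> c" for u
  proof -
    have "T u \<in> {1..card S - 1}" using bij that by (auto simp: bij_betw_def)
    then show ?thesis using pos by auto
  qed
  have "bij_betw (T(c := card S)) (S - {c}) {1..card S - 1}"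
    using bij by (subst bij_betw_cong[of _ _ T]) auto
  moreover have "bij_betw (T(c := card S)) {c} {card S}" by (simp add: bij_betw_def)
  ultimately have "bij_betw (T(c := card S)) ((S - {c}) \<union> {c}) ({1..card S - 1} \<union> {card S})"
    using pos by (intro bij_betw_combine) auto
  moreover have "(S - {c}) \<union> {c} = S" using cS by auto
  moreover have "{1..card S - 1} \<union> {card S} = {1..card S}" using pos by auto
  ultimately have "bij_betw (T(c := card S)) S {1..card S}" by simp
  moreover have "T(c := card S) \<in> extensional S" using ext cS by (auto simp: extensional_def)
  moreover have "(T(c := card S)) (i, j) < (T(c := card S)) (i, j')"
    if "(i, j) \<in> S" "(i, j') \<in> S" "j < j'" for i j j'
    using that T lt cornersD(2)[of a b S j'] c
    by (auto simp: standard_young_tableaux_def ab)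
  moreover have "(T(c := card S)) (i, j) < (T(c := card S)) (i', j)"
    if "(i, j) \<in> S" "(i', j) \<in> S" "i < i'" for i i' j
    using that T lt cornersD(3)[of a b S i'] c
    by (auto simp: standard_young_tableaux_def ab)
  ultimately show ?thesis by (simp add: standard_young_tableaux_def)
qed

text \<open>The cell holding \<open>card S\<close> is a corner, because a later cell in its row or
  column would need a still larger entry. Emptying it leaves a tableau on the other cells.\<close>

lemma standard_young_tableaux_split:
  assumes "finite S" "S \<noteq> {}" and T: "T \<in> standard_young_tableaux S"
  shows "\<exists>c\<in>corners S. T \<in> (\<lambda>T. T(c := card S)) ` standard_young_tableaux (S - {c})"
proof -
  have bij: "bij_betw T S {1..card S}" and ext: "T \<in> extensional S"
    using T by (auto simp: standard_young_tableaux_def)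
  have pos: "card S > 0" using assms by (simp add: card_gt_0_iff)
  then have "card S \<in> T ` S" using bij by (auto simp: bij_betw_def)
  then obtain c where c: "c \<in> S" "T c = card S" by force
  obtain a b where ab: "c = (a, b)" by force
  have le: "T u \<le> card S" if "u \<in> S" for u using bij that by (auto simp: bij_betw_def)
  have corner: "c \<in> corners S"
  proof -
    have "(a, j') \<notin> S" if "b < j'" for j'
      using that T c ab le[of "(a, j')"] unfolding standard_young_tableaux_def by fastforce
    moreover have "(i', b) \<notin> S" if "a < i'" for i'
      using that T c ab le[of "(i', b)"] unfolding standard_young_tableaux_def by fastforce
    ultimately show ?thesis using c ab by (auto simp: corners_def)
  qed
  \<comment> \<open>The value \<open>undefined\<close> at \<open>c\<close> makes \<open>U\<close>
    extensional on \<open>S - {c}\<close>.\<close>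
  define U where "U = T(c := undefined)"
  have card': "card (S - {c}) = card S - 1" using c by simp
  have "bij_betw T (S - {c}) ({1..card S} - {card S})"
    using bij_betw_DiffI[OF bij, of "{c}" "{card S}"] c pos by (auto simp: bij_betw_def)
  moreover have "{1..card S} - {card S} = {1..card S - 1}" by auto
  ultimately have "bij_betw U (S - {c}) {1..card S - 1}"
    unfolding U_def by (subst bij_betw_cong[of _ _ T]) auto
  then have "U \<in> standard_young_tableaux (S - {c})"
    using T ext unfolding standard_young_tableaux_def card'
    by (auto simp: U_def extensional_def)
  moreover have "T = U(c := card S)" using c by (auto simp: U_def)
  ultimately show ?thesis using corner by blast
qed

text \<open>Tableaux are classified by the corner that holds the largest entry; as this entry occurs
  only once, the classes are disjoint.\<close>

lemma num_SYT_corners: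
  assumes fin: "finite S" and ne: "S \<noteq> {}"
  shows "num_SYT S = (\<Sum>c\<in>corners S. num_SYT (S - {c}))"
proof -
  let ?E = "\<lambda>c. (\<lambda>T. T(c := card S)) ` standard_young_tableaux (S - {c})"
  have eq: "standard_young_tableaux S = (\<Union>c\<in>corners S. ?E c)"
    using standard_young_tableaux_extend[OF fin] standard_young_tableaux_split[OF fin ne] by blast
  have fin_corners: "finite (corners S)" using fin corners_subset finite_subset by blast
  have less: "T u < card S" if "T \<in> standard_young_tableaux (S - {c})" "c \<in> corners S"
      "u \<in> S" "u \<noteq> c" for T c u
  proof -
    have cS: "c \<in> S" using that corners_subset by blast
    have "T u \<in> {1..card (S - {c})}"
      using that by (auto simp: standard_young_tableaux_def bij_betw_def)
    then show ?thesis using cS fin card_Diff1_less[OF fin cS] by auto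
  qed
  have disj: "?E c \<inter> ?E d = {}" if "c \<in> corners S" "d \<in> corners S" "c \<noteq> d" for c d
  proof -
    have False if "T \<in> standard_young_tableaux (S - {c})"
      "U \<in> standard_young_tableaux (S - {d})" "T(c := card S) = U(d := card S)" for T U
    proof -
      have "U c = card S" using fun_cong[OF that(3), of c] \<open>c \<noteq> d\<close> by simp
      moreover have "U c < card S"
        using less[OF that(2)] \<open>c \<in> corners S\<close> \<open>d \<in> corners S\<close> \<open>c \<noteq> d\<close> corners_subset by blast
      ultimately show False by simp
    qed
    then show ?thesis by blast
  qed
  \<comment> \<open>The update forgets the value at \<open>c\<close>, but extensionality on
    \<open>S - {c}\<close> had already fixed it to \<open>undefined\<close>.\<close>
  have inj: "inj_on (\<lambda>T. T(c := card S)) (standard_young_tableaux (S - {c}))" for c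
  proof (rule inj_onI, rule ext)
    fix T U u assume "T \<in> standard_young_tableaux (S - {c})" "U \<in> standard_young_tableaux (S - {c})"
      and e: "T(c := card S) = U(c := card S)"
    then have "T c = undefined" "U c = undefined"
      by (auto simp: standard_young_tableaux_def intro: extensional_arb[where A = "S - {c}"])
    then show "T u = U u" using fun_cong[OF e, of u] by (cases "u = c") auto
  qed
  show ?thesis
    unfolding num_SYT_def eq
    using fin fin_corners disj finite_standard_young_tableaux
    by (subst card_UN_disjoint) (auto simp: card_image[OF inj])
qed

lemma num_SYT_empty: "num_SYT {} = 1"
proof -
  have "standard_young_tableaux {} = {\<lambda>_. undefined}"
    by (auto simp: standard_young_tableaux_def bij_betw_def)
  then show ?thesis by (simp add: num_SYT_def)
qed

section \<open>The hook walk\<close>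

definition is_young :: "(nat \<times> nat) set \<Rightarrow> bool" where
  "is_young D \<longleftrightarrow> finite D \<and> (\<forall>i j i' j'. (i, j) \<in> D \<longrightarrow> i' \<le> i \<longrightarrow> j' \<le> j \<longrightarrow> (i', j') \<in> D)"

lemma is_youngD:
  assumes "is_young D"
  shows "finite D" "(i, j) \<in> D \<Longrightarrow> i' \<le> i \<Longrightarrow> j' \<le> j \<Longrightarrow> (i', j') \<in> D"
  using assms unfolding is_young_def by blast+

definition arm :: "(nat \<times> nat) set \<Rightarrow> nat \<Rightarrow> nat \<Rightarrow> nat set" where
  "arm D i j = {j'. j < j' \<and> (i, j') \<in> D}"

definition leg :: "(nat \<times> nat) set \<Rightarrow> nat \<Rightarrow> nat \<Rightarrow> nat set" where
  "leg D i j = {i'. i < i' \<and> (i', j) \<in> D}"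

definition hook :: "(nat \<times> nat) set \<Rightarrow> nat \<times> nat \<Rightarrow> nat" where
  "hook D = (\<lambda>(i, j). card (arm D i j) + card (leg D i j) + 1)"

lemma finite_arm: "finite D \<Longrightarrow> finite (arm D i j)"
  by (rule finite_subset[of _ "snd ` D"]) (force simp: arm_def)+

lemma finite_leg: "finite D \<Longrightarrow> finite (leg D i j)"
  by (rule finite_subset[of _ "fst ` D"]) (force simp: leg_def)+

text \<open>The cells \<open>(a, j)\<close> and \<open>(i, b)\<close> also lie in the diagram, and
  they continue the column and the row of the corner.\<close>

lemma corner_le_eq:
  assumes "is_young D" "(i, j) \<in> corners D" "(a, b) \<in> D" "i \<le> a" "j \<le> b"
  shows "a = i" "b = j"
proof -
  have "(a, j) \<in> D" "(i, b) \<in> D" using assms is_youngD(2)[OF assms(1)] by blast+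
  then show "a = i" "b = j" using cornersD[OF assms(2)] assms by force+
qed

lemma is_young_remove_corner:
  assumes "is_young D" "c \<in> corners D"
  shows "is_young (D - {c})"
  unfolding is_young_def
proof (intro conjI allI impI)
  show "finite (D - {c})" using assms is_youngD by auto
next
  fix i j i' j' assume *: "(i, j) \<in> D - {c}" "i' \<le> i" "j' \<le> j"
  then have "(i', j') \<in> D" using is_youngD(2)[OF assms(1)] by blast
  moreover have "(i', j') \<noteq> c" using corner_le_eq[OF assms(1), of i' j' i j] assms(2) * by auto
  ultimately show "(i', j') \<in> D - {c}" by simp
qed

text \<open>As \<open>(a, b)\<close> is a cell, row \<open>i\<close> contains every column up to
  \<open>b\<close>. The arm of \<open>(i, j)\<close> runs through these columns and then continues
  as the arm of \<open>(i, b)\<close>; legs behave likewise.\<close>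

lemma card_arm_leg_corner:
  assumes "is_young D" "(a, b) \<in> corners D" "i \<le> a" "j \<le> b"
  shows "card (arm D i j) = card (arm D i b) + (b - j)"
    and "card (leg D i j) = card (leg D a j) + (a - i)"
proof -
  have in_D: "(a, b) \<in> D" using assms(2) cornersD by blast
  have "arm D i j = arm D i b \<union> {j<..b}"
    using assms is_youngD(2)[OF assms(1) in_D] by (auto simp: arm_def)
  moreover have "arm D i b \<inter> {j<..b} = {}" by (auto simp: arm_def)
  ultimately show "card (arm D i j) = card (arm D i b) + (b - j)"
    using is_youngD(1)[OF assms(1)] by (simp add: card_Un_disjoint finite_arm)
  have "leg D i j = leg D a j \<union> {i<..a}"
    using assms is_youngD(2)[OF assms(1) in_D] by (auto simp: leg_def)
  moreover have "leg D a j \<inter> {i<..a} = {}" by (auto simp: leg_def)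
  ultimately show "card (leg D i j) = card (leg D a j) + (a - i)"
    using is_youngD(1)[OF assms(1)] by (simp add: card_Un_disjoint finite_leg)
qed

lemma arm_leg_corner_empty:
  assumes "(a, b) \<in> corners D"
  shows "arm D a b = {}" "leg D a b = {}"
  using cornersD[OF assms] by (force simp: arm_def leg_def)+

text \<open>Hook length minus one at \<open>(i, j)\<close> is the sum of its values at the two
  projections to the column and the row of the corner. This additivity lets the endpoint
  probabilities factor into a row part and a column part.\<close>

lemma hook_corner_add:
  assumes "is_young D" "(a, b) \<in> corners D" "i \<le> a" "j \<le> b"
  shows "hook D (i, j) + 1 = hook D (i, b) + hook D (a, j)"
  using card_arm_leg_corner[OF assms] card_arm_leg_corner[OF assms(1,2,3), of b]
    card_arm_leg_corner[OF assms(1,2) _ assms(4), of a] arm_leg_corner_empty[OF assms(2)]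
  by (simp add: hook_def)

text \<open>This product is the sum of the weights from \<open>i\<close> to \<open>a\<close>. Taking
  it as primitive turns the weights into differences, so their sums telescope; the value 0 beyond
  \<open>a\<close> gives the endpoint weight 1.\<close>

definition walk_tail :: "(nat \<Rightarrow> real) \<Rightarrow> nat \<Rightarrow> nat \<Rightarrow> real" where
  "walk_tail w a i = (if i \<le> a then \<Prod>k\<in>{i..<a}. 1 + 1 / w k else 0)"

text \<open>The factor contributed by the rows (or columns) to the probability that a hook walk from
  coordinate \<open>i\<close> ends in coordinate \<open>a\<close>, where \<open>w k + 1\<close> is the length of the hook at
  coordinate \<open>k\<close> in the column (or row) of the endpoint.\<close>

definition walk_weight :: "(nat \<Rightarrow> real) \<Rightarrow> nat \<Rightarrow> nat \<Rightarrow> real" where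
  "walk_weight w a i = walk_tail w a i - walk_tail w a (Suc i)"

lemma walk_weight_end [simp]: "walk_weight w a a = 1"
  by (simp add: walk_weight_def walk_tail_def)

lemma walk_weight_beyond: "a < i \<Longrightarrow> walk_weight w a i = 0"
  by (simp add: walk_weight_def walk_tail_def)

text \<open>The usual form of the Greene--Nijenhuis--Wilf factor: \<open>1 / w i\<close> for the
  start and \<open>1 + 1 / w k\<close> for each \<open>k\<close> strictly between, which the walk
  may visit or skip.\<close>

lemma walk_weight_before:
  assumes "i < a"
  shows "walk_weight w a i = walk_tail w a (Suc i) / w i"
proof -
  have "walk_tail w a i = (1 + 1 / w i) * walk_tail w a (Suc i)"
    using assms by (simp add: walk_tail_def prod.atLeast_Suc_lessThan)
  then show ?thesis by (simp add: walk_weight_def algebra_simps)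
qed

lemma walk_weight_nonneg:
  assumes "\<And>k. k < a \<Longrightarrow> w k > 0"
  shows "walk_weight w a i \<ge> 0"
proof (cases "i < a")
  case True
  have "walk_tail w a (Suc i) \<ge> 0"
    unfolding walk_tail_def using assms
    by (auto intro!: prod_nonneg add_nonneg_nonneg divide_nonneg_nonneg simp: less_imp_le simp del: of_nat_Suc)
  then show ?thesis using assms[OF True] by (simp add: walk_weight_before[OF True])
next
  case False
  then show ?thesis by (cases "i = a") (auto simp: walk_weight_beyond)
qed

lemma sum_walk_weight: "i \<le> Suc a \<Longrightarrow> (\<Sum>k\<in>{i..a}. walk_weight w a k) = walk_tail w a i"
proof (induction rule: inc_induct)
  case base
  then show ?case by (simp add: walk_tail_def)
next
  case (step i)
  then show ?case by (simp add: sum.atLeast_Suc_atMost walk_weight_def)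
qed

text \<open>The step relation in one dimension. Elements of \<open>A\<close> past \<open>a\<close>
  have weight 0, so the sum telescopes to the tail after \<open>i\<close>; for \<open>i = a\<close>
  both sides vanish because \<open>w a = 0\<close>.\<close>

lemma walk_weight_rec:
  assumes "\<And>k. k < a \<Longrightarrow> w k > 0" "w a = 0" "i \<le> a" "finite A" "{i<..a} \<subseteq> A" "A \<subseteq> {i<..}"
  shows "(\<Sum>k\<in>A. walk_weight w a k) = w i * walk_weight w a i"
proof -
  have "(\<Sum>k\<in>A. walk_weight w a k) = (\<Sum>k\<in>{i<..a}. walk_weight w a k)"
    using assms by (intro sum.mono_neutral_right) (auto intro!: walk_weight_beyond)
  also have "{i<..a} = {Suc i..a}" by auto
  also have "(\<Sum>k\<in>{Suc i..a}. walk_weight w a k) = walk_tail w a (Suc i)"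
    using assms by (intro sum_walk_weight) auto
  also have "\<dots> = w i * walk_weight w a i"
  proof (cases "i = a")
    case True
    then show ?thesis using assms by (simp add: walk_tail_def)
  next
    case False
    then show ?thesis using assms by (simp add: walk_weight_before less_imp_neq[THEN not_sym])
  qed
  finally show ?thesis .
qed

text \<open>\<open>A\<close> is an interval ending in \<open>a\<close>, so the telescoped sum is a
  single product.\<close>

lemma sum_walk_weight_upset:
  assumes "a \<in> A" "A \<subseteq> {..a}" "\<And>i i'. i \<in> A \<Longrightarrow> i \<le> i' \<Longrightarrow> i' \<le> a \<Longrightarrow> i' \<in> A"
  shows "(\<Sum>i\<in>A. walk_weight w a i) = (\<Prod>i\<in>A - {a}. 1 + 1 / w i)"
proof -
  define m where "m = (LEAST i. i \<in> A)"
  have "m \<in> A" using assms(1) unfolding m_def by (rule LeastI)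
  have "m \<le> i" if "i \<in> A" for i using that unfolding m_def by (rule Least_le)
  then have "A = {m..a}"
    using assms(2) assms(3)[OF \<open>m \<in> A\<close>] by auto
  moreover have "{m..a} - {a} = {m..<a}" by auto
  ultimately show ?thesis
    using sum_walk_weight[of m a w] \<open>m \<in> A\<close> by (simp add: walk_tail_def)
qed

text \<open>The probability that the hook walk started at \<open>(i, j)\<close> ends at the corner \<open>(a, b)\<close>.\<close>

definition walk_prob :: "(nat \<times> nat) set \<Rightarrow> nat \<times> nat \<Rightarrow> nat \<times> nat \<Rightarrow> real" where
  "walk_prob D = (\<lambda>(a, b) (i, j).
     walk_weight (\<lambda>k. real (hook D (k, b)) - 1) a i * walk_weight (\<lambda>k. real (hook D (a, k)) - 1) b j)"

text \<open>Provides what \<open>walk_weight_rec\<close> asks of its parameters: hook length minus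
  one is positive before the corner and 0 at it.\<close>

lemma hook_corner_line:
  assumes "is_young D" "(a, b) \<in> corners D"
  shows "i < a \<Longrightarrow> real (hook D (i, b)) - 1 > 0" "j < b \<Longrightarrow> real (hook D (a, j)) - 1 > 0"
    "hook D (a, b) = 1"
  using card_arm_leg_corner[OF assms, of i b] card_arm_leg_corner[OF assms, of a j]
    arm_leg_corner_empty[OF assms(2)]
  by (simp_all add: hook_def)

section \<open>Step relation and total mass of the endpoint probabilities\<close>

lemma walk_prob_nonneg:
  assumes "is_young D" "c \<in> corners D"
  shows "walk_prob D c u \<ge> 0"
proof -
  obtain a b i j where eq: "c = (a, b)" "u = (i, j)" by force
  show ?thesis
    unfolding walk_prob_def eq prod.case
    by (intro mult_nonneg_nonneg walk_weight_nonneg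
        hook_corner_line(1,2)[OF assms(1) assms(2)[unfolded eq]])
qed

text \<open>The walk moves to a uniformly chosen other cell of the current hook. This is the
  conditioning on its first step, multiplied by the number of choices.\<close>

lemma walk_prob_rec:
  assumes D: "is_young D" and c: "c \<in> corners D" and u: "(i, j) \<in> D"
  shows "(\<Sum>j'\<in>arm D i j. walk_prob D c (i, j')) + (\<Sum>i'\<in>leg D i j. walk_prob D c (i', j)) =
    (real (hook D (i, j)) - 1) * walk_prob D c (i, j)"
proof -
  obtain a b where ab: "c = (a, b)" by force
  note c' = c[unfolded ab]
  have in_D: "(a, b) \<in> D" using c' cornersD by blast
  define w v where "w = (\<lambda>k. real (hook D (k, b)) - 1)" and "v = (\<lambda>k. real (hook D (a, k)) - 1)"
  have prob: "walk_prob D c (i', j') = walk_weight w a i' * walk_weight v b j'" for i' j'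
    by (simp add: walk_prob_def ab w_def v_def)
  have pos: "\<And>k. k < a \<Longrightarrow> w k > 0" "\<And>k. k < b \<Longrightarrow> v k > 0" "w a = 0" "v b = 0"
    unfolding w_def v_def using hook_corner_line[OF D c'] by simp_all
  show ?thesis
  proof (cases "i \<le> a \<and> j \<le> b")
    case True
    have "(\<Sum>k\<in>arm D i j. walk_weight v b k) = v j * walk_weight v b j"
      using pos True is_youngD(2)[OF D in_D]
      by (intro walk_weight_rec finite_arm is_youngD(1)[OF D]) (auto simp: arm_def)
    moreover have "(\<Sum>k\<in>leg D i j. walk_weight w a k) = w i * walk_weight w a i"
      using pos True is_youngD(2)[OF D in_D]
      by (intro walk_weight_rec finite_leg is_youngD(1)[OF D]) (auto simp: leg_def)
    \<comment> \<open>The arm sum contributes the factor \<open>v j\<close> and the leg sum the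
      factor \<open>w i\<close>; additivity of hooks identifies their sum with the number of
      choices.\<close>
    moreover have "real (hook D (i, j)) - 1 = w i + v j"
      using hook_corner_add[OF D c', of i j] True unfolding w_def v_def by linarith
    ultimately show ?thesis
      unfolding prob
      by (simp add: sum_distrib_left[symmetric] sum_distrib_right[symmetric] algebra_simps)
  next
    case False
    \<comment> \<open>The walk only moves right or down, so from a start that is not weakly
      north-west of the corner every term is 0.\<close>
    then have "walk_weight w a i' * walk_weight v b j' = 0" if "i \<le> i'" "j \<le> j'" for i' j'
      using that by (auto simp: walk_weight_beyond)
    then show ?thesis
      unfolding prob by (subst (1 2) sum.neutral) (auto simp: arm_def leg_def)
  qed
qed

text \<open>Every walk ends in some corner. Each step leaves fewer cells weakly to the south-east,
  which drives the induction, and summing the step relation over the corners preserves total mass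
  1.\<close>

lemma sum_walk_prob:
  assumes D: "is_young D"
  shows "(i, j) \<in> D \<Longrightarrow> (\<Sum>c\<in>corners D. walk_prob D c (i, j)) = 1"
proof (induction "card {(i', j') \<in> D. i \<le> i' \<and> j \<le> j'}" arbitrary: i j rule: less_induct)
  case less
  have fin: "finite D" "finite (corners D)"
    using is_youngD(1)[OF D] corners_subset finite_subset by blast+
  show ?case
  proof (cases "(i, j) \<in> corners D")
    case True
    have zero: "walk_prob D c (i, j) = 0" if "c \<in> corners D - {(i, j)}" for c
    proof -
      obtain a b where ab: "c = (a, b)" by force
      then have "\<not> (i \<le> a \<and> j \<le> b)"
        using corner_le_eq[OF D True, of a b] that cornersD(1)[of a b D] by auto
      then show ?thesis by (auto simp: ab walk_prob_def walk_weight_beyond)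
    qed
    have "(\<Sum>c\<in>corners D. walk_prob D c (i, j)) = (\<Sum>c\<in>{(i, j)}. walk_prob D c (i, j))"
      using fin True zero by (intro sum.mono_neutral_right) auto
    then show ?thesis by (simp add: walk_prob_def)
  next
    case False
    have IH: "(\<Sum>c\<in>corners D. walk_prob D c (i', j')) = 1"
      if "(i', j') \<in> D" "i \<le> i'" "j \<le> j'" "i < i' \<or> j < j'" for i' j'
    proof (rule less.hyps)
      show "card {(x, y) \<in> D. i' \<le> x \<and> j' \<le> y} < card {(x, y) \<in> D. i \<le> x \<and> j \<le> y}"
      proof (rule psubset_card_mono)
        show "finite {(x, y) \<in> D. i \<le> x \<and> j \<le> y}"
          using fin(1) by (rule finite_subset[rotated]) auto
        have "(i, j) \<in> {(x, y) \<in> D. i \<le> x \<and> j \<le> y} - {(x, y) \<in> D. i' \<le> x \<and> j' \<le> y}"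
          using that less.prems by auto
        then show "{(x, y) \<in> D. i' \<le> x \<and> j' \<le> y} \<subset> {(x, y) \<in> D. i \<le> x \<and> j \<le> y}"
          using that by fastforce
      qed
    qed (use that in auto)
    have "(real (hook D (i, j)) - 1) * (\<Sum>c\<in>corners D. walk_prob D c (i, j)) =
      (\<Sum>c\<in>corners D. (\<Sum>j'\<in>arm D i j. walk_prob D c (i, j')) + (\<Sum>i'\<in>leg D i j. walk_prob D c (i', j)))"
      by (simp add: sum_distrib_left walk_prob_rec[OF D _ less.prems])
    also have "\<dots> = (\<Sum>j'\<in>arm D i j. \<Sum>c\<in>corners D. walk_prob D c (i, j')) +
        (\<Sum>i'\<in>leg D i j. \<Sum>c\<in>corners D. walk_prob D c (i', j))"
      unfolding sum.distrib by (intro arg_cong2[of _ _ _ _ "(+)"] sum.swap)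
    also have "\<dots> = (\<Sum>j'\<in>arm D i j. 1) + (\<Sum>i'\<in>leg D i j. 1)"
      by (intro arg_cong2[of _ _ _ _ "(+)"] sum.cong refl IH) (auto simp: arm_def leg_def)
    also have "\<dots> = real (hook D (i, j)) - 1" by (simp add: hook_def)
    finally have eq: "(real (hook D (i, j)) - 1) * (\<Sum>c\<in>corners D. walk_prob D c (i, j)) =
      real (hook D (i, j)) - 1" .
    \<comment> \<open>The hook of a non-corner has a second cell, so the common factor can be
      cancelled.\<close>
    have "arm D i j \<noteq> {} \<or> leg D i j \<noteq> {}"
      using False less.prems by (auto simp: corners_def arm_def leg_def)
    then have "card (arm D i j) > 0 \<or> card (leg D i j) > 0"
      using finite_arm[OF fin(1)] finite_leg[OF fin(1)] by (simp add: card_gt_0_iff)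
    then have "real (hook D (i, j)) - 1 \<noteq> 0" by (auto simp: hook_def)
    then show ?thesis using eq by simp
  qed
qed

section \<open>The hook product under removal of a corner\<close>

text \<open>The hooks are taken in \<open>D\<close>, not in the skew shape. This is the term of
  Naruse's hook length formula that belongs to the excited diagram \<open>M\<close> itself; for
  empty \<open>M\<close> it is the classical hook length formula.\<close>

definition hook_ratio :: "(nat \<times> nat) set \<Rightarrow> (nat \<times> nat) set \<Rightarrow> real" where
  "hook_ratio D M = fact (card (D - M)) / (\<Prod>u\<in>D - M. real (hook D u))"

text \<open>Only the hooks through the corner shrink, and these belong to cells in its row or its
  column.\<close>

lemma hook_remove_corner:
  assumes D: "is_young D" and c: "(a, b) \<in> corners D" and u: "(i, j) \<in> D - {(a, b)}"
  shows "hook D (i, j) = hook (D - {(a, b)}) (i, j) + (if i = a \<or> j = b then 1 else 0)"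
proof -
  have in_D: "(a, b) \<in> D" using c cornersD by blast
  have fin: "finite D" using is_youngD(1)[OF D] .
  consider "i = a" "j < b" | "j = b" "i < a" | "i \<noteq> a" "j \<noteq> b"
    using u cornersD[OF c] by force
  then show ?thesis
  proof cases
    case 1
    have "arm D i j = insert b (arm (D - {(a, b)}) i j)" "leg D i j = leg (D - {(a, b)}) i j"
      using 1 in_D by (auto simp: arm_def leg_def)
    moreover have "b \<notin> arm (D - {(a, b)}) i j" using 1 by (auto simp: arm_def)
    ultimately show ?thesis using 1 fin by (simp add: hook_def finite_arm)
  next
    case 2
    have "leg D i j = insert a (leg (D - {(a, b)}) i j)" "arm D i j = arm (D - {(a, b)}) i j"
      using 2 in_D by (auto simp: arm_def leg_def)
    moreover have "a \<notin> leg (D - {(a, b)}) i j" using 2 by (auto simp: leg_def)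
    ultimately show ?thesis using 2 fin by (simp add: hook_def finite_leg)
  next
    case 3
    then have "leg D i j = leg (D - {(a, b)}) i j" "arm D i j = arm (D - {(a, b)}) i j"
      by (auto simp: arm_def leg_def)
    then show ?thesis using 3 by (simp add: hook_def)
  qed
qed

text \<open>The corner itself has hook length 1. Any other hook of length \<open>h\<close> through
  it drops to \<open>h - 1\<close>, contributing \<open>h / (h - 1) = 1 + 1 / (h - 1)\<close>; the
  remaining hooks cancel, and the factorials leave \<open>card (D - M)\<close>.\<close>

lemma hook_ratio_remove_corner:
  assumes D: "is_young D" and c: "(a, b) \<in> corners D" and notM: "(a, b) \<notin> M"
  shows "real (card (D - M)) * hook_ratio (D - {(a, b)}) M = hook_ratio D M *
    ((\<Prod>i\<in>{i. (i, b) \<in> D - M} - {a}. 1 + 1 / (real (hook D (i, b)) - 1)) *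
     (\<Prod>j\<in>{j. (a, j) \<in> D - M} - {b}. 1 + 1 / (real (hook D (a, j)) - 1)))"
proof -
  define S E where "S = D - M" and "E = D - {(a, b)}"
  have fin: "finite D" "finite S" using is_youngD(1)[OF D] by (auto simp: S_def)
  have cS: "(a, b) \<in> S" using c cornersD(1) notM by (auto simp: S_def)
  have EM: "E - M = S - {(a, b)}" by (auto simp: S_def E_def)
  have hpos: "real (hook F u) > 0" for F u by (auto simp: hook_def split: prod.splits)
  define I J where "I = {i. (i, b) \<in> S} - {a}" and "J = {j. (a, j) \<in> S} - {b}"
  have finIJ: "finite I" "finite J"
    using finite_subset[of I "fst ` S"] finite_subset[of J "snd ` S"] fin
    by (force simp: I_def J_def)+
  have I_less: "i < a" "(i, b) \<in> D" if "i \<in> I" for i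
    using that cornersD(3)[OF c, of i] by (auto simp: I_def S_def)
  have J_less: "j < b" "(a, j) \<in> D" if "j \<in> J" for j
    using that cornersD(2)[OF c, of j] by (auto simp: J_def S_def)
  let ?r = "\<lambda>u. real (hook D u) / real (hook E u)"
  have split: "(\<lambda>i. (i, b)) ` I \<union> Pair a ` J \<subseteq> S - {(a, b)}" by (auto simp: I_def J_def)
  have "(\<Prod>u\<in>S. real (hook D u)) = (\<Prod>u\<in>S - {(a, b)}. real (hook D u))"
    using cS fin by (subst prod.remove[of _ "(a, b)"]) (auto simp: hook_corner_line(3)[OF D c])
  also have "\<dots> = (\<Prod>u\<in>S - {(a, b)}. real (hook E u)) * (\<Prod>u\<in>S - {(a, b)}. ?r u)"
    unfolding prod.distrib[symmetric] using hpos by (intro prod.cong) (auto simp: less_imp_neq[THEN not_sym])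
  also have "(\<Prod>u\<in>S - {(a, b)}. ?r u) = (\<Prod>u\<in>(\<lambda>i. (i, b)) ` I \<union> Pair a ` J. ?r u)"
  proof (rule prod.mono_neutral_right[OF _ split], goal_cases)
    case 1 then show ?case using fin by simp
  next
    case 2
    show ?case
    proof
      fix u assume u: "u \<in> S - {(a, b)} - ((\<lambda>i. (i, b)) ` I \<union> Pair a ` J)"
      obtain i j where ij: "u = (i, j)" by force
      have "i \<noteq> a" "j \<noteq> b" using u by (auto simp: ij I_def J_def)
      then have "hook D u = hook E u"
        using hook_remove_corner[OF D c, of i j] u by (auto simp: ij E_def S_def)
      then show "?r u = 1" using hpos[of E u] by simp
    qed
  qed
  also have "\<dots> = (\<Prod>u\<in>(\<lambda>i. (i, b)) ` I. ?r u) * (\<Prod>u\<in>Pair a ` J. ?r u)"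
    using finIJ by (intro prod.union_disjoint) (auto simp: I_def)
  also have "(\<Prod>u\<in>(\<lambda>i. (i, b)) ` I. ?r u) = (\<Prod>i\<in>I. 1 + 1 / (real (hook D (i, b)) - 1))"
  proof (subst prod.reindex, goal_cases)
    case 2
    have "?r (i, b) = 1 + 1 / (real (hook D (i, b)) - 1)" if "i \<in> I" for i
      using hook_remove_corner[OF D c, of i b] I_less[OF that] hpos[of E "(i, b)"]
      by (simp add: E_def field_simps)
    then show ?case by (intro prod.cong) auto
  qed (auto intro: inj_onI)
  also have "(\<Prod>u\<in>Pair a ` J. ?r u) = (\<Prod>j\<in>J. 1 + 1 / (real (hook D (a, j)) - 1))"
  proof (subst prod.reindex, goal_cases)
    case 2
    have "?r (a, j) = 1 + 1 / (real (hook D (a, j)) - 1)" if "j \<in> J" for j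
      using hook_remove_corner[OF D c, of a j] J_less[OF that] hpos[of E "(a, j)"]
      by (simp add: E_def field_simps)
    then show ?case by (intro prod.cong) auto
  qed (auto intro: inj_onI)
  finally have prod: "(\<Prod>u\<in>S. real (hook D u)) = (\<Prod>u\<in>S - {(a, b)}. real (hook E u)) *
    ((\<Prod>i\<in>I. 1 + 1 / (real (hook D (i, b)) - 1)) * (\<Prod>j\<in>J. 1 + 1 / (real (hook D (a, j)) - 1)))"
    (is "_ = ?e * ?p") .
  have nz: "(\<Prod>u\<in>S. real (hook D u)) \<noteq> 0" "?e \<noteq> 0"
    using fin hpos by (auto simp: less_imp_neq[THEN not_sym])
  have "card S = Suc (card (S - {(a, b)}))" using cS fin(2) by (rule card.remove[rotated])
  then have "(fact (card S) :: real) = real (card S) * fact (card (S - {(a, b)}))"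
    by (metis fact_Suc)
  then have "real (card S) * (fact (card (S - {(a, b)})) / ?e) = fact (card S) / (?e * ?p) * ?p"
    using nz prod by (simp add: field_simps)
  then show ?thesis
    unfolding hook_ratio_def S_def[symmetric] E_def[symmetric] EM prod I_def[symmetric] J_def[symmetric] .
qed

text \<open>Telescoping makes \<open>p\<close> the sum of the endpoint probabilities over
  \<open>I \<times> J\<close>. As \<open>M\<close> is closed to the north-west, every start in
  \<open>D - M\<close> with nonzero probability lies in \<open>I \<times> J\<close>. The latter may
  also contain cells of \<open>M\<close>, whence an inequality that is an equality for empty
  \<open>M\<close>.\<close>

lemma sum_walk_prob_le:
  assumes D: "is_young D" and M: "is_young M" and c: "(a, b) \<in> corners D" and notM: "(a, b) \<notin> M"
  defines "I \<equiv> {i. (i, b) \<in> D - M}" and "J \<equiv> {j. (a, j) \<in> D - M}"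
  defines "p \<equiv> (\<Prod>i\<in>I - {a}. 1 + 1 / (real (hook D (i, b)) - 1)) *
    (\<Prod>j\<in>J - {b}. 1 + 1 / (real (hook D (a, j)) - 1))"
  shows "(\<Sum>u\<in>D - M. walk_prob D (a, b) u) \<le> p"
    and "M = {} \<Longrightarrow> (\<Sum>u\<in>D - M. walk_prob D (a, b) u) = p"
proof -
  have in_D: "(a, b) \<in> D" using c cornersD by blast
  have fin: "finite D" using is_youngD(1)[OF D] .
  have down_D: "(i, j) \<in> D" if "i \<le> a" "j \<le> b" for i j
    using is_youngD(2)[OF D in_D that] .
  have up_M: "(i', j') \<notin> M" if "(i, j) \<notin> M" "i \<le> i'" "j \<le> j'" for i j i' j'
    using is_youngD(2)[OF M _ that(2,3)] that(1) by blast
  have I: "a \<in> I" "I \<subseteq> {..a}" "\<And>i i'. i \<in> I \<Longrightarrow> i \<le> i' \<Longrightarrow> i' \<le> a \<Longrightarrow> i' \<in> I"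
    unfolding I_def using in_D notM cornersD(3)[OF c] down_D up_M by blast+
  have J: "b \<in> J" "J \<subseteq> {..b}" "\<And>j j'. j \<in> J \<Longrightarrow> j \<le> j' \<Longrightarrow> j' \<le> b \<Longrightarrow> j' \<in> J"
    unfolding J_def using in_D notM cornersD(2)[OF c] down_D up_M by blast+
  have finIJ: "finite I" "finite J" using I(2) J(2) finite_subset by auto
  have zero: "walk_prob D (a, b) (i, j) = 0" if "\<not> (i \<le> a \<and> j \<le> b)" for i j
    using that by (auto simp: walk_prob_def walk_weight_beyond)
  have "(\<Sum>u\<in>I \<times> J. walk_prob D (a, b) u) =
      (\<Sum>i\<in>I. walk_weight (\<lambda>k. real (hook D (k, b)) - 1) a i) *
      (\<Sum>j\<in>J. walk_weight (\<lambda>k. real (hook D (a, k)) - 1) b j)"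
    unfolding walk_prob_def by (simp add: sum.cartesian_product sum_product)
  also have "(\<Sum>i\<in>I. walk_weight (\<lambda>k. real (hook D (k, b)) - 1) a i) =
      (\<Prod>i\<in>I - {a}. 1 + 1 / (real (hook D (i, b)) - 1))"
    using I by (rule sum_walk_weight_upset)
  also have "(\<Sum>j\<in>J. walk_weight (\<lambda>k. real (hook D (a, k)) - 1) b j) =
      (\<Prod>j\<in>J - {b}. 1 + 1 / (real (hook D (a, j)) - 1))"
    using J by (rule sum_walk_weight_upset)
  finally have total: "(\<Sum>u\<in>I \<times> J. walk_prob D (a, b) u) = p"
    unfolding p_def .
  have sub: "u \<in> I \<times> J" if "u \<in> D - M" "walk_prob D (a, b) u \<noteq> 0" for u
  proof -
    obtain i j where ij: "u = (i, j)" by force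
    have "i \<le> a" "j \<le> b" using that zero[of i j] by (auto simp: ij)
    moreover have "(i, j) \<notin> M" using that by (simp add: ij)
    ultimately have "(i, b) \<in> D - M" "(a, j) \<in> D - M"
      using down_D up_M[of i j] by auto
    then show ?thesis by (simp add: ij I_def J_def)
  qed
  have "(\<Sum>u\<in>D - M. walk_prob D (a, b) u) = (\<Sum>u\<in>(D - M) \<inter> (I \<times> J). walk_prob D (a, b) u)"
    using fin sub by (intro sum.mono_neutral_right) auto
  also have "\<dots> \<le> (\<Sum>u\<in>I \<times> J. walk_prob D (a, b) u)"
    using finIJ walk_prob_nonneg[OF D c] by (intro sum_mono2) auto
  finally show "(\<Sum>u\<in>D - M. walk_prob D (a, b) u) \<le> p" unfolding total .
  assume "M = {}"
  have "I \<times> J \<subseteq> D" using I(2) J(2) down_D by auto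
  then show "(\<Sum>u\<in>D - M. walk_prob D (a, b) u) = p"
    unfolding total[symmetric] using fin sub \<open>M = {}\<close> by (intro sum.mono_neutral_right) auto
qed

lemma hook_ratio_nonneg: "hook_ratio D M \<ge> 0"
  by (simp add: hook_ratio_def prod_nonneg)

lemma hook_ratio_pos: "hook_ratio D M > 0"
  by (auto simp: hook_ratio_def hook_def intro!: divide_pos_pos prod_pos)

text \<open>Double counting: over all starts in \<open>D - M\<close> and all corners the
  probabilities add up to \<open>card (D - M)\<close>, while each corner \<open>c\<close> receives
  at most \<open>p c\<close>, which is \<open>card (D - M)\<close> times the quotient of the hook
  ratios after and before its removal.\<close>

lemma hook_ratio_le_sum:
  assumes D: "is_young D" and M: "is_young M" and ne: "D - M \<noteq> {}"
  shows "hook_ratio D M \<le> (\<Sum>c\<in>corners D - M. hook_ratio (D - {c}) M)"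
    and "M = {} \<Longrightarrow> hook_ratio D M = (\<Sum>c\<in>corners D - M. hook_ratio (D - {c}) M)"
proof -
  have fin: "finite D" "finite (corners D)"
    using is_youngD(1)[OF D] corners_subset finite_subset by blast+
  have card: "real (card (D - M)) = (\<Sum>c\<in>corners D - M. \<Sum>u\<in>D - M. walk_prob D c u)"
  proof -
    \<comment> \<open>A walk that ends in \<open>M\<close> has started weakly north-west of its end,
      hence in \<open>M\<close>.\<close>
    have zero: "walk_prob D c (i, j) = 0" if "c \<in> corners D" "c \<in> M" "(i, j) \<in> D - M" for c i j
    proof -
      obtain a b where ab: "c = (a, b)" by force
      then have "\<not> (i \<le> a \<and> j \<le> b)" using is_youngD(2)[OF M, of a b] that by auto
      then show ?thesis by (auto simp: ab walk_prob_def walk_weight_beyond)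
    qed
    have "(\<Sum>u\<in>D - M. \<Sum>c\<in>corners D. walk_prob D c u) = (\<Sum>u\<in>D - M. 1)"
      using sum_walk_prob[OF D] by (intro sum.cong) auto
    then have "real (card (D - M)) = (\<Sum>u\<in>D - M. \<Sum>c\<in>corners D. walk_prob D c u)"
      by simp
    also have "\<dots> = (\<Sum>u\<in>D - M. \<Sum>c\<in>corners D - M. walk_prob D c u)"
      using fin zero by (intro sum.cong sum.mono_neutral_right) auto
    finally show ?thesis by (subst sum.swap)
  qed
  define p where "p = (\<lambda>(a, b).
    (\<Prod>i\<in>{i. (i, b) \<in> D - M} - {a}. 1 + 1 / (real (hook D (i, b)) - 1)) *
    (\<Prod>j\<in>{j. (a, j) \<in> D - M} - {b}. 1 + 1 / (real (hook D (a, j)) - 1)))"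
  have rem: "real (card (D - M)) * hook_ratio (D - {c}) M = hook_ratio D M * p c"
    if "c \<in> corners D - M" for c
    using that hook_ratio_remove_corner[OF D, of "fst c" "snd c" M] by (cases c) (simp add: p_def)
  have le: "(\<Sum>u\<in>D - M. walk_prob D c u) \<le> p c" if "c \<in> corners D - M" for c
    using that sum_walk_prob_le(1)[OF D M, of "fst c" "snd c"] by (cases c) (simp add: p_def)
  have pos: "real (card (D - M)) > 0" using ne fin by (simp add: card_gt_0_iff)
  have sum: "real (card (D - M)) * (\<Sum>c\<in>corners D - M. hook_ratio (D - {c}) M) =
      hook_ratio D M * (\<Sum>c\<in>corners D - M. p c)"
    by (simp add: sum_distrib_left rem)
  have "real (card (D - M)) \<le> (\<Sum>c\<in>corners D - M. p c)"
    unfolding card by (intro sum_mono le)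
  then have "real (card (D - M)) * hook_ratio D M \<le>
      real (card (D - M)) * (\<Sum>c\<in>corners D - M. hook_ratio (D - {c}) M)"
    unfolding sum using mult_left_mono[OF _ hook_ratio_nonneg[of D M]] by (subst mult.commute)
  then show "hook_ratio D M \<le> (\<Sum>c\<in>corners D - M. hook_ratio (D - {c}) M)"
    using pos mult_le_cancel_left_pos by blast
  assume "M = {}"
  then have "(\<Sum>u\<in>D - M. walk_prob D c u) = p c" if "c \<in> corners D - M" for c
    using that sum_walk_prob_le(2)[OF D M, of "fst c" "snd c"] by (cases c) (simp add: p_def)
  then have "real (card (D - M)) = (\<Sum>c\<in>corners D - M. p c)"
    unfolding card by (intro sum.cong) auto
  with sum pos show "hook_ratio D M = (\<Sum>c\<in>corners D - M. hook_ratio (D - {c}) M)"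
    by simp
qed

section \<open>Bounds on the number of skew tableaux\<close>

lemma corners_skew:
  assumes "is_young D" "is_young M"
  shows "corners (D - M) = corners D - M"
  using is_youngD(2)[OF assms(2)] unfolding corners_def by fastforce

lemma num_SYT_skew_corners:
  assumes "is_young D" "is_young M" "D - M \<noteq> {}"
  shows "num_SYT (D - M) = (\<Sum>c\<in>corners D - M. num_SYT (D - {c} - M))"
proof -
  have "D - M - {c} = D - {c} - M" for c by auto
  then show ?thesis
    using num_SYT_corners[of "D - M"] assms is_youngD(1)[OF assms(1)] corners_skew[OF assms(1,2)]
    by simp
qed

text \<open>Tableaux satisfy with equality the corner recursion that the hook ratio satisfies with
  \<le>, and both equal 1 on the empty shape.\<close>

theorem hook_ratio_le_num_SYT:
  assumes "is_young D" "is_young M"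
  shows "hook_ratio D M \<le> real (num_SYT (D - M))"
  using assms
proof (induction "card (D - M)" arbitrary: D rule: less_induct)
  case less
  show ?case
  proof (cases "D - M = {}")
    case True
    then show ?thesis unfolding hook_ratio_def True by (simp add: num_SYT_empty)
  next
    case False
    have fin: "finite (D - M)" using is_youngD(1)[OF less.prems(1)] by simp
    have "hook_ratio D M \<le> (\<Sum>c\<in>corners D - M. hook_ratio (D - {c}) M)"
      using hook_ratio_le_sum(1)[OF less.prems False] .
    also have "\<dots> \<le> (\<Sum>c\<in>corners D - M. real (num_SYT (D - {c} - M)))"
    proof (intro sum_mono less.hyps less.prems)
      fix c assume c: "c \<in> corners D - M"
      then show "is_young (D - {c})" using is_young_remove_corner[OF less.prems(1)] by blast
      have "c \<in> D - M" using c corners_subset by blast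
      then show "card (D - {c} - M) < card (D - M)" using fin by (intro psubset_card_mono) auto
    qed
    also have "\<dots> = real (num_SYT (D - M))"
      by (simp add: num_SYT_skew_corners[OF less.prems False])
    finally show ?thesis .
  qed
qed

text \<open>By the hook length formula the two ratios count the tableaux of \<open>M\<close> and of
  \<open>D\<close>, so this is the bound that comes from gluing a tableau of \<open>D - M\<close>
  onto one of \<open>M\<close>. The induction compares the two corner recursions.\<close>

theorem num_SYT_mult_hook_ratio_le:
  assumes "is_young D" "is_young M" "M \<subseteq> D"
  shows "real (num_SYT (D - M)) * hook_ratio M {} \<le> hook_ratio D {}"
  using assms
proof (induction "card (D - M)" arbitrary: D rule: less_induct)
  case less
  show ?case
  proof (cases "D - M = {}")
    case True
    then have "D = M" using less.prems by auto
    then show ?thesis by (simp add: num_SYT_empty)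
  next
    case False
    have fin: "finite D" "finite (corners D)"
      using is_youngD(1)[OF less.prems(1)] corners_subset finite_subset by blast+
    have empty: "is_young {}" by (simp add: is_young_def)
    have "D \<noteq> {}" using False by auto
    have "real (num_SYT (D - M)) * hook_ratio M {} =
        (\<Sum>c\<in>corners D - M. real (num_SYT (D - {c} - M)) * hook_ratio M {})"
      by (simp add: num_SYT_skew_corners[OF less.prems(1,2) False] sum_distrib_right)
    also have "\<dots> \<le> (\<Sum>c\<in>corners D - M. hook_ratio (D - {c}) {})"
    proof (intro sum_mono less.hyps less.prems(2))
      fix c assume c: "c \<in> corners D - M"
      then show "is_young (D - {c})" using is_young_remove_corner[OF less.prems(1)] by blast
      have "c \<in> D - M" using c corners_subset by blast
      then show "card (D - {c} - M) < card (D - M)" using fin by (intro psubset_card_mono) auto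
      show "M \<subseteq> D - {c}" using c less.prems by auto
    qed
    \<comment> \<open>The recursion for \<open>D\<close> runs over all its corners; those in
      \<open>M\<close> enter as extra nonnegative terms.\<close>
    also have "\<dots> \<le> (\<Sum>c\<in>corners D - {}. hook_ratio (D - {c}) {})"
      using fin by (intro sum_mono2) (auto simp: hook_ratio_nonneg)
    also have "\<dots> = hook_ratio D {}"
      using hook_ratio_le_sum(2)[OF less.prems(1) empty] \<open>D \<noteq> {}\<close> by simp
    finally show ?thesis .
  qed
qed

section \<open>Hooks of staircases\<close>

lemma is_young_staircase: "is_young (young_diagram (staircase m))"
  unfolding is_young_def using finite_young_diagram_staircase
  by (auto simp: young_diagram_staircase)

text \<open>Arm and leg both extend to the outer antidiagonal and have the same length
  \<open>m - 2 - (i + j)\<close>.\<close>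

lemma hook_staircase:
  assumes "i + j + 1 < m"
  shows "hook (young_diagram (staircase m)) (i, j) = 2 * (m - 2 - (i + j)) + 1"
proof -
  have "arm (young_diagram (staircase m)) i j = {j<..<m - 1 - i}"
    "leg (young_diagram (staircase m)) i j = {i<..<m - 1 - j}"
    by (auto simp: arm_def leg_def young_diagram_staircase)
  then show ?thesis using assms by (simp add: hook_def)
qed

text \<open>\<open>d = m - 2 - (i + j)\<close> is the distance of a cell from the outer
  antidiagonal. Row \<open>i\<close> has \<open>r = m - Suc i\<close> cells, at distances
  \<open>0, ..., r - 1\<close>, and the strip keeps those below \<open>q\<close>.\<close>

lemma sum_staircase_strip:
  fixes g :: "nat \<Rightarrow> real"
  shows "(\<Sum>(i, j)\<in>{(i, j). i + j + 1 < m \<and> m - 2 - (i + j) < q}. g (m - 2 - (i + j))) =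
    (\<Sum>r<m. \<Sum>d<min q r. g d)"
proof -
  have eq: "{(i, j). i + j + 1 < m \<and> m - 2 - (i + j) < q} =
      (SIGMA i:{..<m}. {j. i + j + 1 < m \<and> m - 2 - (i + j) < q})" by auto
  have fin: "finite {j. i + j + 1 < m \<and> m - 2 - (i + j) < q}" for i
    by (rule finite_subset[of _ "{..<m}"]) auto
  have "(\<Sum>(i, j)\<in>{(i, j). i + j + 1 < m \<and> m - 2 - (i + j) < q}. g (m - 2 - (i + j))) =
      (\<Sum>i<m. \<Sum>j | i + j + 1 < m \<and> m - 2 - (i + j) < q. g (m - 2 - (i + j)))"
    unfolding eq using fin by (subst sum.Sigma) auto
  also have "\<dots> = (\<Sum>i<m. \<Sum>d<min q (m - Suc i). g d)"
  proof (rule sum.cong[OF refl])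
    fix i assume "i \<in> {..<m}"
    then show "(\<Sum>j | i + j + 1 < m \<and> m - 2 - (i + j) < q. g (m - 2 - (i + j))) =
        (\<Sum>d<min q (m - Suc i). g d)"
      by (intro sum.reindex_bij_witness[of _ "\<lambda>d. m - 2 - (i + d)" "\<lambda>j. m - 2 - (i + j)"]) auto
  qed
  also have "\<dots> = (\<Sum>r<m. \<Sum>d<min q r. g d)"
    by (rule sum.nat_diff_reindex)
  finally show ?thesis .
qed

text \<open>The logarithm of the double factorial (2m-1)!!, which is the hook product of a staircase
  row with \<open>m\<close> cells.\<close>

definition log_odds :: "nat \<Rightarrow> real" where
  "log_odds m = (\<Sum>d<m. ln (2 * real d + 1))"

text \<open>The logarithm of the full hook product of \<open>staircase m\<close>, collected by row
  length \<open>r\<close>.\<close>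

definition log_stair :: "nat \<Rightarrow> real" where
  "log_stair m = (\<Sum>r<m. log_odds r)"

text \<open>\<open>D - M\<close> consists of the \<open>q\<close> outermost antidiagonals. The case
  \<open>q = m\<close> is the whole staircase, and \<open>m = 2 * k\<close>, \<open>q = k\<close> is
  \<open>upsilon k\<close>.\<close>

lemma ln_hook_ratio_strip:
  assumes "young_diagram (staircase m) - M = {(i, j). i + j + 1 < m \<and> m - 2 - (i + j) < q}"
  shows "ln (hook_ratio (young_diagram (staircase m)) M) =
    ln (fact (card (young_diagram (staircase m) - M))) - (\<Sum>r<m. log_odds (min q r))"
proof -
  let ?S = "young_diagram (staircase m) - M"
  have fin: "finite ?S" using finite_young_diagram_staircase by blast
  have pos: "real (hook D u) > 0" for D u by (auto simp: hook_def split: prod.splits)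
  have "ln (\<Prod>u\<in>?S. real (hook (young_diagram (staircase m)) u)) =
      (\<Sum>u\<in>?S. ln (real (hook (young_diagram (staircase m)) u)))"
    using fin pos by (subst ln_prod) auto
  also have "\<dots> = (\<Sum>(i, j)\<in>?S. ln (2 * real (m - 2 - (i + j)) + 1))"
    by (intro sum.cong) (auto simp: assms hook_staircase)
  also have "\<dots> = (\<Sum>r<m. log_odds (min q r))"
    unfolding assms log_odds_def by (rule sum_staircase_strip)
  finally show ?thesis
    unfolding hook_ratio_def using fin pos by (subst ln_div) (auto intro!: prod_pos)
qed

lemma ln_hook_ratio_staircase:
  "ln (hook_ratio (young_diagram (staircase m)) {}) =
    ln (fact (card (young_diagram (staircase m)))) - log_stair m"
proof -
  have "young_diagram (staircase m) - {} = {(i, j). i + j + 1 < m \<and> m - 2 - (i + j) < m}"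
    by (auto simp: young_diagram_staircase)
  from ln_hook_ratio_strip[OF this] show ?thesis
    by (simp add: log_stair_def min_def)
qed

lemma ln_hook_ratio_upsilon:
  "ln (hook_ratio (young_diagram (staircase (2 * k))) (young_diagram (staircase k))) =
    ln (fact (card (upsilon k))) - log_stair k - real k * log_odds k"
proof -
  have "young_diagram (staircase (2 * k)) - young_diagram (staircase k) =
      {(i, j). i + j + 1 < 2 * k \<and> 2 * k - 2 - (i + j) < k}"
    by (auto simp: young_diagram_staircase)
  note * = ln_hook_ratio_strip[OF this]
  have split: "{..<2 * k} = {..<k} \<union> {k..<2 * k}" by auto
  \<comment> \<open>Rows with fewer than \<open>k\<close> cells lie wholly in the strip; each of the
    other \<open>k\<close> rows keeps its last \<open>k\<close> cells.\<close>
  have "(\<Sum>r<2 * k. log_odds (min k r)) = log_stair k + real k * log_odds k"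
    unfolding split log_stair_def by (subst sum.union_disjoint) auto
  with * show ?thesis by (simp add: upsilon_def skew_shape_def)
qed

section \<open>Logarithmic bounds for the number of tableaux of \<open>upsilon k\<close>\<close>

lemma num_SYT_upsilon_pos: "num_SYT (upsilon k) > 0"
  using hook_ratio_le_num_SYT[OF is_young_staircase is_young_staircase, of "2 * k" k]
    hook_ratio_pos[of "young_diagram (staircase (2 * k))" "young_diagram (staircase k)"]
  by (simp add: upsilon_def skew_shape_def)

lemma ln_num_SYT_upsilon_ge:
  "ln (fact (card (upsilon k))) - log_stair k - real k * log_odds k \<le> ln (num_SYT (upsilon k))"
proof -
  have "ln (hook_ratio (young_diagram (staircase (2 * k))) (young_diagram (staircase k))) \<le>
      ln (num_SYT (upsilon k))"
    using hook_ratio_le_num_SYT[OF is_young_staircase is_young_staircase] hook_ratio_pos num_SYT_upsilon_pos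
    by (subst ln_le_cancel_iff) (auto simp: upsilon_def skew_shape_def)
  then show ?thesis unfolding ln_hook_ratio_upsilon .
qed

lemma ln_num_SYT_upsilon_le:
  "ln (num_SYT (upsilon k)) \<le>
    (ln (fact (card (young_diagram (staircase (2 * k))))) - log_stair (2 * k)) -
    (ln (fact (card (young_diagram (staircase k)))) - log_stair k)"
proof -
  have "real (num_SYT (upsilon k)) * hook_ratio (young_diagram (staircase k)) {} \<le>
      hook_ratio (young_diagram (staircase (2 * k))) {}"
    using num_SYT_mult_hook_ratio_le[OF is_young_staircase is_young_staircase young_diagram_staircase_subset]
    by (simp add: upsilon_def skew_shape_def)
  then have "ln (real (num_SYT (upsilon k)) * hook_ratio (young_diagram (staircase k)) {}) \<le>
      ln (hook_ratio (young_diagram (staircase (2 * k))) {})"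
    using hook_ratio_pos num_SYT_upsilon_pos by (subst ln_le_cancel_iff) auto
  moreover have "ln (real (num_SYT (upsilon k)) * hook_ratio (young_diagram (staircase k)) {}) =
      ln (num_SYT (upsilon k)) + ln (hook_ratio (young_diagram (staircase k)) {})"
    using hook_ratio_pos num_SYT_upsilon_pos by (intro ln_mult_pos) auto
  ultimately show ?thesis unfolding ln_hook_ratio_staircase by linarith
qed

section \<open>Asymptotics\<close>

text \<open>From some \<open>N\<close> on, the increments of \<open>z = x - l * y\<close> are at
  most \<open>r / 2\<close> times those of \<open>y\<close>. Summing them bounds
  \<open>z n - z N\<close>, and the constant \<open>z N\<close> is absorbed because \<open>y\<close>
  is unbounded.\<close>

lemma stolz_cesaro:
  fixes x y :: "nat \<Rightarrow> real"
  assumes inc: "\<And>n. y n < y (Suc n)" and lim: "filterlim y at_top sequentially"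
    and diff: "(\<lambda>n. (x (Suc n) - x n) / (y (Suc n) - y n)) \<longlonglongrightarrow> l"
  shows "(\<lambda>n. x n / y n) \<longlonglongrightarrow> l"
proof (rule LIMSEQ_I)
  fix r :: real assume r: "r > 0"
  obtain N where N: "\<And>n. n \<ge> N \<Longrightarrow> \<bar>(x (Suc n) - x n) / (y (Suc n) - y n) - l\<bar> < r / 2"
    using LIMSEQ_D[OF diff, of "r / 2"] r by auto
  define z where "z = (\<lambda>n. x n - l * y n)"
  have incr: "\<bar>z (Suc n) - z n\<bar> \<le> r / 2 * (y (Suc n) - y n)" if "n \<ge> N" for n
  proof -
    have pos: "y (Suc n) - y n > 0" using inc[of n] by simp
    have "z (Suc n) - z n = ((x (Suc n) - x n) / (y (Suc n) - y n) - l) * (y (Suc n) - y n)"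
      using pos by (simp add: z_def field_simps)
    then have "\<bar>z (Suc n) - z n\<bar> = \<bar>(x (Suc n) - x n) / (y (Suc n) - y n) - l\<bar> * (y (Suc n) - y n)"
      using pos by (simp add: abs_mult)
    then show ?thesis using N[OF that] pos by (simp add: mult_right_mono)
  qed
  have bound: "\<bar>z n - z N\<bar> \<le> r / 2 * (y n - y N)" if "n \<ge> N" for n
    using that
  proof (induction rule: dec_induct)
    case (step n)
    have "\<bar>z (Suc n) - z N\<bar> \<le> \<bar>z (Suc n) - z n\<bar> + \<bar>z n - z N\<bar>" by linarith
    then show ?case using step incr[of n] by (simp add: algebra_simps)
  qed simp
  show "\<exists>n0. \<forall>n\<ge>n0. norm (x n / y n - l) < r"
  proof -
    have "\<forall>\<^sub>F n in sequentially. n \<ge> N \<and> y n > 0 \<and> y n > 2 / r * \<bar>z N\<bar> - y N"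
      using lim unfolding filterlim_at_top_dense by (intro eventually_conj eventually_ge_at_top) auto
    then have "\<forall>\<^sub>F n in sequentially. norm (x n / y n - l) < r"
    proof eventually_elim
      case (elim n)
      \<comment> \<open>Added to \<open>bound\<close>, this yields \<open>r * y n\<close>, since the
        two occurrences of \<open>y N\<close> cancel.\<close>
      then have "\<bar>z N\<bar> < r / 2 * (y n + y N)" using r by (simp add: field_simps)
      then have "\<bar>z n\<bar> < r * y n" using bound[of n] elim by (simp add: abs_if algebra_simps split: if_splits)
      moreover have "x n / y n - l = z n / y n" using elim by (simp add: z_def field_simps)
      ultimately show ?case using elim by (simp add: field_simps)
    qed
    then show ?thesis by (simp add: eventually_sequentially)
  qed
qed

text \<open>Stirling's formula up to o(n). The increments are elementary, so Stolz--Cesaro applies;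
  the next two expansions follow the same scheme.\<close>

lemma tendsto_log_fact: "(\<lambda>n. (ln (fact n) - real n * ln (real n)) / real n) \<longlonglongrightarrow> -1"
proof (rule stolz_cesaro)
  have "(\<lambda>n::nat. ln (real n + 1) - ((real n + 1) * ln (real n + 1) - real n * ln (real n))) \<longlonglongrightarrow> -1"
    by real_asymp
  moreover have "ln (fact (Suc n)) = ln (real n + 1) + ln (fact n :: real)" for n
    unfolding fact_Suc by (subst ln_mult_pos) (auto simp: add.commute)
  ultimately show "(\<lambda>n. (ln (fact (Suc n)) - real (Suc n) * ln (real (Suc n)) -
      (ln (fact n) - real n * ln (real n))) / (real (Suc n) - real n)) \<longlonglongrightarrow> -1"
    by (simp add: algebra_simps del: fact_Suc)
qed (auto intro: filterlim_real_sequentially)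

lemma tendsto_log_odds: "(\<lambda>n. (log_odds n - real n * ln (real n)) / real n) \<longlonglongrightarrow> ln 2 - 1"
proof (rule stolz_cesaro)
  have "(\<lambda>n::nat. ln (2 * real n + 1) - ((real n + 1) * ln (real n + 1) - real n * ln (real n))) \<longlonglongrightarrow> ln 2 - 1"
    by real_asymp
  then show "(\<lambda>n. (log_odds (Suc n) - real (Suc n) * ln (real (Suc n)) -
      (log_odds n - real n * ln (real n))) / (real (Suc n) - real n)) \<longlonglongrightarrow> ln 2 - 1"
    by (simp add: log_odds_def algebra_simps)
qed (auto intro: filterlim_real_sequentially)

text \<open>The increment of \<open>log_stair\<close> is \<open>log_odds n\<close>, so the previous
  expansion supplies (ln 2 - 1)/2, and the comparison function \<open>n^2 / 2 * ln n\<close>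
  supplies -1/4.\<close>

lemma tendsto_log_stair:
  "(\<lambda>n. (log_stair n - (real n)\<^sup>2 / 2 * ln (real n)) / (real n)\<^sup>2) \<longlonglongrightarrow> ln 2 / 2 - 3 / 4"
proof (rule stolz_cesaro)
  let ?t = "\<lambda>n. (log_odds n - real n * ln (real n)) / real n"
  \<comment> \<open>This factor passes from the divisor \<open>n\<close> of \<open>?t\<close> to the
    increment \<open>2 * n + 1\<close> of the squares.\<close>
  have "(\<lambda>n::nat. real n / (2 * real n + 1)) \<longlonglongrightarrow> 1 / 2" by real_asymp
  then have "(\<lambda>n. ?t n * (real n / (2 * real n + 1))) \<longlonglongrightarrow> (ln 2 - 1) * (1 / 2)"
    by (intro tendsto_mult tendsto_log_odds)
  moreover have "(\<lambda>n::nat. (real n * ln (real n) -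
      ((real n + 1)\<^sup>2 / 2 * ln (real n + 1) - (real n)\<^sup>2 / 2 * ln (real n))) / (2 * real n + 1)) \<longlonglongrightarrow> - (1 / 4)"
    by real_asymp
  ultimately have "(\<lambda>n. ?t n * (real n / (2 * real n + 1)) + (real n * ln (real n) -
      ((real n + 1)\<^sup>2 / 2 * ln (real n + 1) - (real n)\<^sup>2 / 2 * ln (real n))) / (2 * real n + 1)) \<longlonglongrightarrow>
      (ln 2 - 1) * (1 / 2) + - (1 / 4)"
    by (rule tendsto_add)
  moreover have "?t n * (real n / (2 * real n + 1)) + (real n * ln (real n) -
      ((real n + 1)\<^sup>2 / 2 * ln (real n + 1) - (real n)\<^sup>2 / 2 * ln (real n))) / (2 * real n + 1) =
      (log_stair (Suc n) - (real (Suc n))\<^sup>2 / 2 * ln (real (Suc n)) -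
      (log_stair n - (real n)\<^sup>2 / 2 * ln (real n))) / ((real (Suc n))\<^sup>2 - (real n)\<^sup>2)" for n
  proof -
    \<comment> \<open>At \<open>n = 0\<close> both sides are 0, because
      \<open>log_odds 0 = 0\<close>.\<close>
    have "?t n * (real n / (2 * real n + 1)) = (log_odds n - real n * ln (real n)) / (2 * real n + 1)"
      by (cases "n = 0") (auto simp: log_odds_def)
    moreover have "(real (Suc n))\<^sup>2 - (real n)\<^sup>2 = 2 * real n + 1"
      by (simp add: power2_eq_square algebra_simps)
    moreover have "real (Suc n) = real n + 1" by simp
    moreover have "log_stair (Suc n) = log_stair n + log_odds n" by (simp add: log_stair_def)
    ultimately show ?thesis by (simp only: add_divide_distrib[symmetric]) simp
  qed
  moreover have "(ln 2 - 1) * (1 / 2) + - (1 / 4) = ln 2 / 2 - (3 / 4 :: real)" by (simp add: field_simps)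
  ultimately show "(\<lambda>n. (log_stair (Suc n) - (real (Suc n))\<^sup>2 / 2 * ln (real (Suc n)) -
      (log_stair n - (real n)\<^sup>2 / 2 * ln (real n))) / ((real (Suc n))\<^sup>2 - (real n)\<^sup>2)) \<longlonglongrightarrow> ln 2 / 2 - 3 / 4"
    by simp
next
  show "filterlim (\<lambda>n. (real n)\<^sup>2) at_top sequentially" by real_asymp
qed (simp add: power2_eq_square algebra_simps)

section \<open>Growth constants of the two bounds\<close>

lemma real_card_upsilon: "real (card (upsilon k)) = real k * (3 * real k - 1) / 2"
proof -
  have "even (k * (3 * k - 1))" by (cases k) auto
  then have "2 * card (upsilon k) = k * (3 * k - 1)" unfolding card_upsilon by simp
  then have "2 * real (card (upsilon k)) = real (k * (3 * k - 1))"
    by (metis of_nat_mult of_nat_numeral)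
  then show ?thesis by (cases k) (auto simp: algebra_simps)
qed

lemma real_card_staircase: "real (card (young_diagram (staircase k))) = real k * (real k - 1) / 2"
proof -
  have "2 * real (card (young_diagram (staircase k))) = real (k * (k - 1))"
    using card_young_diagram_staircase[of k] by (metis of_nat_mult of_nat_numeral)
  then show ?thesis by (cases k) (auto simp: algebra_simps)
qed

lemma tendsto_hook_lower_bound:
  defines "n \<equiv> \<lambda>k. real (card (upsilon k))"
  shows "(\<lambda>k. 1 / n k * (ln (fact (card (upsilon k))) - log_stair k - real k * log_odds k
      - 1 / 2 * n k * ln (n k))) \<longlonglongrightarrow> 1 / 6 - 3 / 2 * ln 2 + 1 / 2 * ln 3"
proof -
  define f where "f = (\<lambda>n. (ln (fact n) - real n * ln (real n)) / real n)"
  define t where "t = (\<lambda>n. (log_odds n - real n * ln (real n)) / real n)"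
  define s where "s = (\<lambda>n. (log_stair n - (real n)\<^sup>2 / 2 * ln (real n)) / (real n)\<^sup>2)"
  note n = n_def[unfolded real_card_upsilon]
  have n_top: "filterlim n at_top sequentially" unfolding n by real_asymp
  have "filterlim (\<lambda>k. card (upsilon k)) sequentially sequentially"
    using n_top unfolding n_def filterlim_sequentially_iff_filterlim_real .
  from filterlim_compose[OF tendsto_log_fact this]
  have "(\<lambda>k. f (card (upsilon k))) \<longlonglongrightarrow> -1" unfolding f_def .
  moreover have "s \<longlonglongrightarrow> ln 2 / 2 - 3 / 4" using tendsto_log_stair unfolding s_def .
  moreover have "t \<longlonglongrightarrow> ln 2 - 1" using tendsto_log_odds unfolding t_def .
  moreover have "(\<lambda>k. (real k)\<^sup>2 / n k) \<longlonglongrightarrow> 2 / 3" unfolding n by real_asymp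
  \<comment> \<open>All explicit logarithms: half of \<open>n * ln n\<close> survives from the
    factorial, against \<open>k^2 / 2 * ln k\<close> from \<open>log_stair\<close> and
    \<open>k^2 * ln k\<close> from \<open>k * log_odds k\<close>. As n is asymptotic to 3/2 k^2, the
    multiples of ln k cancel and 1/2 ln(3/2) remains.\<close>
  moreover have "(\<lambda>k. 1 / 2 * ln (n k) - (real k)\<^sup>2 / n k * (3 / 2 * ln (real k))) \<longlonglongrightarrow> 1 / 2 * ln (3 / 2)"
    unfolding n by real_asymp
  ultimately have "(\<lambda>k. (1 / 2 * ln (n k) - (real k)\<^sup>2 / n k * (3 / 2 * ln (real k))) + f (card (upsilon k))
      - (real k)\<^sup>2 / n k * (s k + t k)) \<longlonglongrightarrow>
      1 / 2 * ln (3 / 2) + (-1) - 2 / 3 * ((ln 2 / 2 - 3 / 4) + (ln 2 - 1))"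
    by (intro tendsto_add tendsto_diff tendsto_mult)
  also have "1 / 2 * ln (3 / 2) + (-1) - 2 / 3 * ((ln 2 / 2 - 3 / 4) + (ln 2 - 1)) =
      1 / 6 - 3 / 2 * ln 2 + 1 / 2 * ln (3::real)"
    by (simp add: ln_div field_simps)
  finally show ?thesis
  proof (rule Lim_transform_eventually)
    show "\<forall>\<^sub>F k in sequentially. (1 / 2 * ln (n k) - (real k)\<^sup>2 / n k * (3 / 2 * ln (real k))) + f (card (upsilon k))
      - (real k)\<^sup>2 / n k * (s k + t k) = 1 / n k * (ln (fact (card (upsilon k))) - log_stair k - real k * log_odds k
      - 1 / 2 * n k * ln (n k))"
      using eventually_gt_at_top[of 0] n_top[unfolded filterlim_at_top_dense, rule_format, of 0]
    proof eventually_elim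
      case (elim k)
      have "ln (fact (card (upsilon k))) = n k * ln (n k) + n k * f (card (upsilon k))"
        "log_stair k = (real k)\<^sup>2 / 2 * ln (real k) + (real k)\<^sup>2 * s k"
        "log_odds k = real k * ln (real k) + real k * t k"
        using elim by (simp_all add: f_def s_def t_def n_def)
      then show ?case using elim by (simp add: field_simps power2_eq_square)
    qed
  qed
qed

lemma tendsto_hook_upper_bound:
  defines "n \<equiv> \<lambda>k. real (card (upsilon k))"
  shows "(\<lambda>k. 1 / n k * ((ln (fact (card (young_diagram (staircase (2 * k))))) - log_stair (2 * k)) -
    (ln (fact (card (young_diagram (staircase k)))) - log_stair k) - 1 / 2 * n k * ln (n k)))
    \<longlonglongrightarrow> 1 / 2 - 1 / 6 * ln 2 - 1 / 2 * ln 3"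
proof -
  define c where "c = (\<lambda>k. card (young_diagram (staircase k)))"
  define N M where "N = (\<lambda>k. real (c (2 * k)))" and "M = (\<lambda>k. real (c k))"
  define f where "f = (\<lambda>n. (ln (fact n) - real n * ln (real n)) / real n)"
  define s where "s = (\<lambda>n. (log_stair n - (real n)\<^sup>2 / 2 * ln (real n)) / (real n)\<^sup>2)"
  \<comment> \<open>\<open>E\<close> gathers the explicit logarithmic main terms; what is left of
    each expansion is a convergent sequence \<open>f\<close> or \<open>s\<close>.\<close>
  define E where "E = (\<lambda>k. (N k * ln (N k) - M k * ln (M k) - 2 * (real k)\<^sup>2 * ln (2 * real k)
      + (real k)\<^sup>2 / 2 * ln (real k)) / n k - 1 / 2 * ln (n k))"
  have c_eq: "card (young_diagram (staircase m)) = c m" for m by (simp add: c_def)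
  note n = n_def[unfolded real_card_upsilon]
  have N: "N = (\<lambda>k. real k * (2 * real k - 1))" and M: "M = (\<lambda>k. real k * (real k - 1) / 2)"
    unfolding N_def M_def c_def real_card_staircase by auto
  have tops: "filterlim n at_top sequentially" "filterlim N at_top sequentially" "filterlim M at_top sequentially"
    unfolding n N M by real_asymp+
  have "filterlim (\<lambda>k. c (2 * k)) sequentially sequentially" "filterlim c sequentially sequentially"
    using tops(2,3) unfolding N_def M_def filterlim_sequentially_iff_filterlim_real .
  from this[THEN filterlim_compose[OF tendsto_log_fact]]
  have "(\<lambda>k. f (c (2 * k))) \<longlonglongrightarrow> -1" "(\<lambda>k. f (c k)) \<longlonglongrightarrow> -1" unfolding f_def .
  moreover have "(\<lambda>k. s (2 * k)) \<longlonglongrightarrow> ln 2 / 2 - 3 / 4"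
    using tendsto_log_stair unfolding s_def
    by (rule filterlim_compose) (simp add: filterlim_sequentially_iff_filterlim_real, real_asymp)
  moreover have "s \<longlonglongrightarrow> ln 2 / 2 - 3 / 4" using tendsto_log_stair unfolding s_def .
  moreover have "(\<lambda>k. (real k)\<^sup>2 / n k) \<longlonglongrightarrow> 2 / 3" "(\<lambda>k. N k / n k) \<longlonglongrightarrow> 4 / 3" "(\<lambda>k. M k / n k) \<longlonglongrightarrow> 1 / 3"
    unfolding n N M by real_asymp+
  moreover have "E \<longlonglongrightarrow> 5 / 6 * ln 2 - 1 / 2 * ln 3"
  proof -
    \<comment> \<open>In units of k^2, the sizes N, M, n tend to 2, 1/2, 3/2. The multiples of ln k
      cancel, and the four terms come in turn from N ln N, M ln M, ln(2k) and ln n.\<close>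
    have "E \<longlonglongrightarrow> 4 / 3 * ln 2 - 1 / 3 * ln (1 / 2) - 4 / 3 * ln 2 - 1 / 2 * ln (3 / 2)"
      unfolding E_def n N M by real_asymp
    then show ?thesis by (simp add: ln_div field_simps)
  qed
  ultimately have "(\<lambda>k. E k + N k / n k * f (c (2 * k)) - M k / n k * f (c k)
      - 4 * ((real k)\<^sup>2 / n k) * s (2 * k) + (real k)\<^sup>2 / n k * s k) \<longlonglongrightarrow>
      (5 / 6 * ln 2 - 1 / 2 * ln 3) + 4 / 3 * (-1) - 1 / 3 * (-1) - 4 * (2 / 3) * (ln 2 / 2 - 3 / 4)
      + 2 / 3 * (ln 2 / 2 - 3 / 4)"
    by (intro tendsto_add tendsto_diff tendsto_mult tendsto_const)
  also have "(5 / 6 * ln 2 - 1 / 2 * ln 3) + 4 / 3 * (-1) - 1 / 3 * (-1) - 4 * (2 / 3) * (ln 2 / 2 - 3 / 4)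
      + 2 / 3 * (ln 2 / 2 - 3 / 4) = 1 / 2 - 1 / 6 * ln 2 - 1 / 2 * ln (3::real)"
    by (simp add: field_simps)
  finally show ?thesis
  proof (rule Lim_transform_eventually)
    show "\<forall>\<^sub>F k in sequentially. E k + N k / n k * f (c (2 * k)) - M k / n k * f (c k)
      - 4 * ((real k)\<^sup>2 / n k) * s (2 * k) + (real k)\<^sup>2 / n k * s k =
      1 / n k * ((ln (fact (card (young_diagram (staircase (2 * k))))) - log_stair (2 * k)) -
      (ln (fact (card (young_diagram (staircase k)))) - log_stair k) - 1 / 2 * n k * ln (n k))"
      using eventually_gt_at_top[of 0] tops[unfolded filterlim_at_top_dense, rule_format, of 0]
    proof eventually_elim
      case (elim k)
      have "ln (fact (c (2 * k))) = N k * ln (N k) + N k * f (c (2 * k))"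
        "ln (fact (c k)) = M k * ln (M k) + M k * f (c k)"
        "log_stair (2 * k) = 2 * (real k)\<^sup>2 * ln (2 * real k) + 4 * (real k)\<^sup>2 * s (2 * k)"
        "log_stair k = (real k)\<^sup>2 / 2 * ln (real k) + (real k)\<^sup>2 * s k"
        using elim by (simp_all add: f_def s_def N_def M_def power_mult_distrib)
      then show ?case using elim unfolding c_eq E_def by (simp add: field_simps)
    qed
  qed
qed

text \<open>Six times the gap is 15 ln 3 - 20 ln 2 - 2. Since 2^20 < 3^13, it exceeds 2 ln 3 - 2,
  which is nonnegative because e \<le> 3.\<close>

lemma upper_constant_less: "1 / 2 - 1 / 6 * ln 2 - 1 / 2 * ln 3 < 1 / 6 - 7 / 2 * ln 2 + 2 * ln (3::real)"
proof -
  have "20 * ln 2 = ln ((2::real) ^ 20)" by (subst ln_realpow) simp_all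
  also have "\<dots> < ln (3 ^ 13)" by (subst ln_less_cancel_iff) simp_all
  also have "\<dots> = 13 * ln (3::real)" by (subst ln_realpow) simp_all
  finally have "20 * ln 2 < 13 * ln (3::real)" .
  moreover have "1 \<le> ln (3::real)" using exp_le by (subst ln_ge_iff) simp_all
  ultimately show ?thesis by simp
qed

theorem theorem1p1:
  "\<exists>\<epsilon>\<^sub>1 \<epsilon>\<^sub>2 :: nat \<Rightarrow> real. \<epsilon>\<^sub>1 \<in> o(\<lambda>_. 1) \<and> \<epsilon>\<^sub>2 \<in> o(\<lambda>_. 1) \<and>
     (\<forall>k\<ge>1. let n = real (card (upsilon k)); f = real (num_SYT (upsilon k)) in
        1/6 - 3/2 * ln 2 + 1/2 * ln 3 + \<epsilon>\<^sub>1 k \<le> 1/n * (ln f - 1/2 * n * ln n) \<and>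
        1/n * (ln f - 1/2 * n * ln n) \<le> 1/6 - 7/2 * ln 2 + 2 * ln 3 + \<epsilon>\<^sub>2 k)"
proof -
  define n where "n = (\<lambda>k. real (card (upsilon k)))"
  define L where "L = (\<lambda>k. 1 / n k * (ln (fact (card (upsilon k))) - log_stair k - real k * log_odds k
      - 1 / 2 * n k * ln (n k)))"
  define U where "U = (\<lambda>k. 1 / n k * ((ln (fact (card (young_diagram (staircase (2 * k))))) - log_stair (2 * k)) -
    (ln (fact (card (young_diagram (staircase k)))) - log_stair k) - 1 / 2 * n k * ln (n k)))"
  define l u :: real where "l = 1/6 - 3/2 * ln 2 + 1/2 * ln 3" and "u = 1/6 - 7/2 * ln 2 + 2 * ln 3"
  have "L \<longlonglongrightarrow> l" unfolding L_def n_def l_def by (rule tendsto_hook_lower_bound)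
  then have "(\<lambda>k. L k - l) \<longlonglongrightarrow> 0" by (simp add: LIM_zero)
  then have "(\<lambda>k. L k - l) \<in> o(\<lambda>_. 1)" by (intro smalloI_tendsto) auto
  \<comment> \<open>The second error term vanishes eventually, as the limit of \<open>U\<close> is
    below \<open>u\<close>; the maximum covers the finitely many \<open>k\<close> where
    \<open>U k\<close> may exceed \<open>u\<close>.\<close>
  moreover have "(\<lambda>k. max 0 (U k - u)) \<in> o(\<lambda>_. 1)"
  proof (rule smalloI_tendsto)
    have "U \<longlonglongrightarrow> 1 / 2 - 1 / 6 * ln 2 - 1 / 2 * ln 3"
      unfolding U_def n_def by (rule tendsto_hook_upper_bound)
    from order_tendstoD(2)[OF this upper_constant_less[folded u_def]]
    have "\<forall>\<^sub>F k in sequentially. max 0 (U k - u) = 0" by eventually_elim simp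
    then have "(\<lambda>k. max 0 (U k - u)) \<longlonglongrightarrow> 0" by (rule tendsto_eventually)
    then show "(\<lambda>k. max 0 (U k - u) / 1) \<longlonglongrightarrow> 0" by simp
  qed simp
  moreover have "L k \<le> 1 / n k * (ln (num_SYT (upsilon k)) - 1 / 2 * n k * ln (n k))"
    "1 / n k * (ln (num_SYT (upsilon k)) - 1 / 2 * n k * ln (n k)) \<le> U k" for k
    unfolding L_def U_def using ln_num_SYT_upsilon_ge[of k] ln_num_SYT_upsilon_le[of k]
    by (intro mult_left_mono; simp add: n_def)+
  then have "l + (L k - l) \<le> 1 / n k * (ln (num_SYT (upsilon k)) - 1 / 2 * n k * ln (n k)) \<and>
      1 / n k * (ln (num_SYT (upsilon k)) - 1 / 2 * n k * ln (n k)) \<le> u + max 0 (U k - u)" for k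
    by (smt (verit))
  ultimately show ?thesis
    unfolding Let_def l_def[symmetric] u_def[symmetric] n_def by blast
qed

end
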